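(* Let $\lambda_B$ be the main eigenvalue of the random Ruelle operator $\mathscr{L}_{B_{t(\cdot)}}$, let $h_B$ be its positive continuous eigenfunction, and let $\{X_s:0\le s\le1\}$ be the càdlàg process with paths in $\mathscr{D}[0,1]$ determined by $\Theta(X_{(\cdot)})=h_B$. Then almost surely the following stochastic functional equation holds for all $t\in[0,1]$: $$\exp(B_{\frac t2})\,X_{\frac t2}+\exp(B_{\frac12+\frac t2})\,X_{\frac12+\frac t2}=\lambda_B X_t.$$
   Context: Let $\Omega=\{0,1\}^{\mathbb{N}}$ with $\mathbb{N}=\{1,2,\ldots\}$, a compact metric space with the metric $d(x,y)=2^{-N}$, $N=\inf\{i\in\mathbb{N}: x_i\neq y_i\}$. $C(\Omega)$ is the space of real continuous functions on $\Omega$ with the supremum norm. For $f\in C(\Omega)$ the Ruelle operator $\mathscr{L}_f:C(\Omega)\to C(\Omega)$ is $\mathscr{L}_f(\varphi)(x)=\sum_{a=0,1}\exp(f(ax))\varphi(ax)$, where $ax=(a,x_1,x_2,\ldots)$. Define (abusing notation) $t:\Omega\to[0,1]$ by $t(x)=\sum_{n\ge1}2^{-n}x_n$; in the claim, $t$ denotes a number in $[0,1]$. Let $\{B_s:s\in[0,1]\}$ be a standard one-dimensional Brownian motion (with $B_0=0$ and almost surely continuous paths) on a complete probability space. The Brownian potential is the random function $x\mapsto B_{t(x)}$ on $\Omega$; it is almost surely $\gamma$-Hölder continuous for every $0<\gamma<1/2$. By the Ruelle–Perron–Frobenius theorem for Hölder potentials, almost surely the spectral radius $\lambda_B$ of $\mathscr{L}_{B_{t(\cdot)}}$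 is an eigenvalue (the main eigenvalue) of geometric multiplicity one, with a strictly positive continuous eigenfunction $h_B$ given by $h_B(x)=\lim_{n\to\infty}\lambda_B^{-n}\mathscr{L}^n_{B_{t(\cdot)}}(1)(x)$ (uniform limit). Let $\mathscr{D}=\{s\in[0,1]:\#t^{-1}(s)=2\}$ and let $\prec_{\mathrm{Lex}}$ be the strict lexicographic order on $\Omega$. $\mathscr{D}[0,1]$ is the set of $F:[0,1]\to\mathbb{R}$ continuous at every point of $[0,1]\setminus\mathscr{D}$ and such that for each $r\in\mathscr{D}$ the left limit $\lim_{s\uparrow r}F(s)$ exists and $\lim_{s\downarrow r}F(s)=F(r)$. The linear bijection $\Theta:\mathscr{D}[0,1]\to C(\Omega)$ sends $F$ to the function $f$ with $f(x)=F(t(x))$ if $t(x)\notin\mathscr{D}$, and, if $t(x)=t(y)\in\mathscr{D}$ with $x\prec_{\mathrm{Lex}}y$, $f(x)=\lim_{s\uparrow t(x)}F(s)$ and $f(y)=F(t(y))$. *)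

theory Defs
  imports "HOL-Probability.Probability"
begin

section \<open>The space \<open>\<Omega>\<close> and the binary expansion map\<close>

text \<open>
  \<open>\<Omega>\<close> is the type \<open>nat \<Rightarrow> bool\<close>, with \<open>False\<close>, \<open>True\<close> for the symbols 0, 1. Coordinates are
  numbered from 0, so the coordinate \<open>x\<^sub>i\<close> of the text (\<open>i = 1, 2, \<dots>\<close>) is \<open>x (i - 1)\<close> here.
  The topology is the library's product topology; \<open>open_iff_seq_dist\<close> below shows that it is the
  one induced by \<open>d(x,y) = 2\<^sup>-\<^sup>N\<close>. Since \<open>\<Omega>\<close> is compact, \<open>C(\<Omega>)\<close> with the supremum norm is the
  type of bounded continuous functions \<open>(nat \<Rightarrow> bool) \<Rightarrow>\<^sub>C real\<close>.
\<close>

type_synonym binseq = "nat \<Rightarrow> bool"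

definition seq_dist :: "binseq \<Rightarrow> binseq \<Rightarrow> real" where
  "seq_dist x y = (if x = y then 0 else (1/2) ^ Suc (LEAST i. x i \<noteq> y i))"

lemma seq_dist_less_iff: "seq_dist x y < (1/2) ^ n \<longleftrightarrow> (\<forall>i<n. x i = y i)"
proof (cases "x = y")
  case True
  then show ?thesis by (simp add: seq_dist_def)
next
  case False
  define L where "L = (LEAST i. x i \<noteq> y i)"
  have L: "x L \<noteq> y L"
    unfolding L_def by (rule LeastI_ex) (use False in blast)
  have below: "x i = y i" if "i < L" for i
    using not_less_Least[OF that[unfolded L_def]] by simp
  have "seq_dist x y < (1/2) ^ n \<longleftrightarrow> n < Suc L"
    using False unfolding seq_dist_def L_def[symmetric]
    by (simp add: power_strict_decreasing_iff del: power_Suc)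
  also have "\<dots> \<longleftrightarrow> (\<forall>i<n. x i = y i)"
    using L below by (auto simp: less_Suc_eq_le intro: leI)
  finally show ?thesis .
qed

lemma open_iff_seq_dist:
  fixes U :: "binseq set"
  shows "open U \<longleftrightarrow> (\<forall>x\<in>U. \<exists>e>0. \<forall>y. seq_dist x y < e \<longrightarrow> y \<in> U)"
proof
  assume U: "open U"
  show "\<forall>x\<in>U. \<exists>e>0. \<forall>y. seq_dist x y < e \<longrightarrow> y \<in> U"
  proof
    fix x assume "x \<in> U"
    have "\<exists>X. x \<in> (\<Pi>\<^sub>E i\<in>UNIV. X i) \<and> (\<forall>i. openin euclidean (X i))
        \<and> finite {i. X i \<noteq> topspace euclidean} \<and> (\<Pi>\<^sub>E i\<in>UNIV. X i) \<subseteq> U"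
      using product_topology_open_contains_basis[OF U[unfolded open_fun_def] \<open>x \<in> U\<close>] by simp
    then obtain X where X: "x \<in> (\<Pi>\<^sub>E i\<in>UNIV. X i)" "finite {i. X i \<noteq> UNIV}"
        "(\<Pi>\<^sub>E i\<in>UNIV. X i) \<subseteq> U"
      by auto
    obtain n where n: "{i. X i \<noteq> UNIV} \<subseteq> {..<n}"
      using X(2) finite_nat_iff_bounded by blast
    have "y \<in> U" if "seq_dist x y < (1/2) ^ n" for y
    proof -
      have "y i \<in> X i" for i
      proof (cases "i < n")
        case True
        then show ?thesis using that PiE_mem[OF X(1), of i] by (simp add: seq_dist_less_iff)
      next
        case False
        then show ?thesis using n by blast
      qed
      then show ?thesis using X(3) by auto
    qed
    then show "\<exists>e>0. \<forall>y. seq_dist x y < e \<longrightarrow> y \<in> U"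
      by (intro exI[of _ "(1/2) ^ n"]) auto
  qed
next
  assume *: "\<forall>x\<in>U. \<exists>e>0. \<forall>y. seq_dist x y < e \<longrightarrow> y \<in> U"
  show "open U"
  proof (rule open_subopen[THEN iffD2], intro ballI)
    fix x assume "x \<in> U"
    from bspec[OF * this] obtain e where e: "e > 0" "\<And>y. seq_dist x y < e \<Longrightarrow> y \<in> U"
      by blast
    obtain n where n: "(1/2) ^ n < e"
      using real_arch_pow_inv[OF e(1), of "1/2"] by auto
    define V where "V = (\<Inter>i\<in>{..<n}. (\<lambda>y::binseq. y i) -` {x i})"
    have "open V"
      unfolding V_def
      by (intro open_INT ballI open_vimage continuous_on_product_coordinates)
        (auto intro: Topological_Spaces.open_discrete)
    moreover have "x \<in> V"
      by (simp add: V_def)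
    moreover have "V \<subseteq> U"
    proof
      fix y assume "y \<in> V"
      then have "seq_dist x y < (1/2) ^ n"
        by (auto simp: V_def seq_dist_less_iff)
      then show "y \<in> U" using n e(2) by fastforce
    qed
    ultimately show "\<exists>T. open T \<and> x \<in> T \<and> T \<subseteq> U" by blast
  qed
qed

lemma compact_UNIV_binseq: "compact (UNIV :: binseq set)"
proof -
  have "compact_space (product_topology (\<lambda>i::nat. euclidean :: bool topology) UNIV)"
    by (rule compact_space_product_topology[THEN iffD2]) (simp add: compact_space_def finite_imp_compact)
  then show ?thesis
    by (simp add: euclidean_product_topology compact_space_def)
qed

definition bin_val :: "binseq \<Rightarrow> real" where
  "bin_val x = (\<Sum>n. (1/2) ^ Suc n * of_bool (x n))"

definition lex_less :: "binseq \<Rightarrow> binseq \<Rightarrow> bool" where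
  "lex_less x y \<longleftrightarrow> (\<exists>n. (\<forall>i<n. x i = y i) \<and> \<not> x n \<and> y n)"

definition prepend :: "bool \<Rightarrow> binseq \<Rightarrow> binseq" where
  "prepend a x = case_nat a x"

lemma continuous_on_prepend: "continuous_on UNIV (prepend a)"
proof (rule continuous_on_coordinatewise_then_product)
  show "continuous_on UNIV (\<lambda>x. prepend a x i)" for i
    by (cases i) (auto simp: prepend_def intro: continuous_on_product_coordinates)
qed


section \<open>Ruelle operator and main eigenvalue\<close>

setup_lifting type_definition_bcontfun

lift_definition ruelle ::
  "(binseq \<Rightarrow>\<^sub>C real) \<Rightarrow> (binseq \<Rightarrow>\<^sub>C real) \<Rightarrow> (binseq \<Rightarrow>\<^sub>C real)" is
  "\<lambda>f \<phi> x. \<Sum>a\<in>UNIV. exp (f (prepend a x)) * \<phi> (prepend a x)"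
proof -
  fix f \<phi> :: "binseq \<Rightarrow> real"
  assume "f \<in> bcontfun" "\<phi> \<in> bcontfun"
  then have c: "continuous_on UNIV f" "continuous_on UNIV \<phi>"
    by (auto simp: bcontfun_def)
  have "continuous_on UNIV (\<lambda>x. \<Sum>a\<in>UNIV. exp (f (prepend a x)) * \<phi> (prepend a x))"
    by (intro continuous_intros continuous_on_compose2[OF c(1)] continuous_on_compose2[OF c(2)]
        continuous_on_prepend) auto
  then show "(\<lambda>x. \<Sum>a\<in>UNIV. exp (f (prepend a x)) * \<phi> (prepend a x)) \<in> bcontfun"
    using compact_continuous_image[OF _ compact_UNIV_binseq] compact_imp_bounded
    by (auto simp: bcontfun_def)
qed

text \<open>
  The spectrum of an operator \<open>T\<close> on a real Banach space is that of its complexification: \<open>(u, v)\<close>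
  stands for \<open>u + i v\<close>, and \<open>z\<close> is spectral iff \<open>T - z\<close> has no bounded two-sided inverse.
\<close>

definition complexified_minus :: "('a::real_normed_vector \<Rightarrow> 'a) \<Rightarrow> complex \<Rightarrow> 'a \<times> 'a \<Rightarrow> 'a \<times> 'a" where
  "complexified_minus T z = (\<lambda>(u, v).
     (T u - (Re z *\<^sub>R u - Im z *\<^sub>R v), T v - (Re z *\<^sub>R v + Im z *\<^sub>R u)))"

definition op_spectrum :: "('a::real_normed_vector \<Rightarrow> 'a) \<Rightarrow> complex set" where
  "op_spectrum T = {z. \<not> (\<exists>S. bounded_linear S
      \<and> S \<circ> complexified_minus T z = id \<and> complexified_minus T z \<circ> S = id)}"

definition op_spectral_radius :: "('a::real_normed_vector \<Rightarrow> 'a) \<Rightarrow> real" where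
  "op_spectral_radius T = (SUP z\<in>op_spectrum T. norm z)"

definition main_eigenvalue :: "(binseq \<Rightarrow>\<^sub>C real) \<Rightarrow> real" where
  "main_eigenvalue f = op_spectral_radius (ruelle f)"

definition is_positive_main_eigenfunction :: "(binseq \<Rightarrow>\<^sub>C real) \<Rightarrow> (binseq \<Rightarrow>\<^sub>C real) \<Rightarrow> bool" where
  "is_positive_main_eigenfunction f h \<longleftrightarrow>
     (\<forall>x. 0 < apply_bcontfun h x) \<and> ruelle f h = main_eigenvalue f *\<^sub>R h"


section \<open>The bijection \<open>\<Theta>\<close>\<close>

definition double_points :: "real set" where
  "double_points = {s\<in>{0..1}. card {x. bin_val x = s} = 2}"

text \<open>
  Functions on \<open>[0,1]\<close> are functions on \<open>real\<close> whose values outside \<open>[0,1]\<close> are never used; every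
  point of \<open>double_points\<close> is interior to \<open>[0,1]\<close>, so the unrestricted one-sided filters suffice.
\<close>

definition D_paths :: "(real \<Rightarrow> real) set" where
  "D_paths = {F.
     (\<forall>s\<in>{0..1} - double_points. continuous (at s within {0..1}) F) \<and>
     (\<forall>r\<in>double_points. (\<exists>l. (F \<longlongrightarrow> l) (at_left r)) \<and> (F \<longlongrightarrow> F r) (at_right r))}"

definition Theta :: "(real \<Rightarrow> real) \<Rightarrow> binseq \<Rightarrow> real" where
  "Theta F x =
     (if bin_val x \<in> double_points \<and> (\<exists>y. bin_val y = bin_val x \<and> lex_less x y)
      then Lim (at_left (bin_val x)) F
      else F (bin_val x))"


section \<open>Brownian motion on \<open>[0,1]\<close> and the Brownian potential\<close>

definition std_brownian_motion :: "'w measure \<Rightarrow> (real \<Rightarrow> 'w \<Rightarrow> real) \<Rightarrow> bool" where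
  "std_brownian_motion M B \<longleftrightarrow>
     prob_space M \<and>
     (\<forall>s\<in>{0..1}. B s \<in> borel_measurable M) \<and>
     (AE \<omega> in M. B 0 \<omega> = 0) \<and>
     (\<forall>(n::nat) \<tau>. strict_mono_on {..n} \<tau> \<and> \<tau> ` {..n} \<subseteq> {0..1} \<longrightarrow>
        prob_space.indep_vars M (\<lambda>_. borel) (\<lambda>i \<omega>. B (\<tau> (Suc i)) \<omega> - B (\<tau> i) \<omega>) {..<n}) \<and>
     (\<forall>s r. 0 \<le> s \<and> s < r \<and> r \<le> 1 \<longrightarrow>
        distributed M lborel (\<lambda>\<omega>. B r \<omega> - B s \<omega>) (normal_density 0 (sqrt (r - s)))) \<and>
     (AE \<omega> in M. continuous_on {0..1} (\<lambda>s. B s \<omega>))"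

text \<open>
  For a continuous path the following is the element \<open>x \<mapsto> B\<^bsub>t(x)\<^esub>(\<omega>)\<close> of \<open>C(\<Omega>)\<close>; on the null
  set of discontinuous paths its value is irrelevant.
\<close>

definition brownian_potential :: "(real \<Rightarrow> 'w \<Rightarrow> real) \<Rightarrow> 'w \<Rightarrow> (binseq \<Rightarrow>\<^sub>C real)" where
  "brownian_potential B \<omega> = Bcontfun (\<lambda>x. B (bin_val x) \<omega>)"

end

theory Submission
  imports Defs
begin

text \<open>
  The eigenfunction \<open>h\<close> is constant on the fibres of \<open>bin_val\<close>. Suppose \<open>h u \<le> c * h v\<close> whenever \<open>u\<close>,
  \<open>v\<close> lie in the same fibre and agree on their first \<open>n + 1\<close> coordinates. Since the potential
  factors through \<open>bin_val\<close>, the eigenvalue equation extends this to \<open>u\<close>, \<open>v\<close> that agree on \<open>n\<close>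
  coordinates only, hence down to \<open>n = 0\<close>. By compactness such an \<open>n\<close> exists for every \<open>c > 1\<close>.
  Hence \<open>h x = X (bin_val x)\<close> for all \<open>x\<close>, the left limits in \<open>\<Theta>\<close> play no role, and the functional
  equation is the eigenvalue equation at any binary expansion of \<open>t\<close>. Constancy on
  fibres is essential for \<open>t = 1\<close>: its only expansion 111\<dots> has the preimage 0111\<dots>, where \<open>\<Theta>\<close>
  takes the left limit of \<open>X\<close> at \<open>1/2\<close>.
\<close>

section \<open>Binary values of sequences\<close>

lemma summable_bin_val: "summable (\<lambda>n. (1/2::real) ^ Suc n * of_bool (x n))"
  by (rule summable_comparison_test'[where g = "\<lambda>n. (1/2) ^ n" and N = 0])
    (auto simp: summable_geometric)

lemma bin_val_prepend: "bin_val (prepend a x) = of_bool a / 2 + bin_val x / 2"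
proof -
  have "bin_val (prepend a x) = (1/2) * of_bool a + (\<Sum>n. (1/2) ^ Suc (Suc n) * of_bool (x n))"
    using suminf_split_head[OF summable_bin_val[of "prepend a x"]]
    unfolding bin_val_def by (simp add: prepend_def)
  also have "(\<Sum>n. (1/2::real) ^ Suc (Suc n) * of_bool (x n)) = (1/2) * bin_val x"
    unfolding bin_val_def by (subst suminf_mult[OF summable_bin_val, symmetric]) (simp add: mult.assoc)
  finally show ?thesis by simp
qed

lemma bin_val_in_unit_interval: "bin_val x \<in> {0..1}"
proof -
  have s: "summable (\<lambda>n. (1/2::real) ^ Suc n)"
    using summable_bin_val[of "\<lambda>_. True"] by simp
  have "bin_val x \<le> (\<Sum>n. (1/2) ^ Suc n)"
    unfolding bin_val_def by (rule suminf_le[OF _ summable_bin_val s]) auto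
  also have "\<dots> = 1" using power_half_series by (simp add: sums_iff)
  finally show ?thesis
    by (auto simp: bin_val_def intro!: suminf_nonneg summable_bin_val[simplified])
qed

text \<open>Each partial sum depends on finitely many discrete coordinates, and the geometric
  majorant makes their convergence uniform.\<close>

lemma continuous_on_bin_val: "continuous_on UNIV bin_val"
proof (rule uniform_limit_theorem)
  show "uniform_limit UNIV (\<lambda>n x. \<Sum>i<n. (1/2) ^ Suc i * of_bool (x i)) bin_val sequentially"
    unfolding bin_val_def
    by (rule Weierstrass_m_test[where M = "\<lambda>n. (1/2) ^ Suc n"])
      (use summable_bin_val[of "\<lambda>_. True"] in auto)
  have "continuous_on UNIV (\<lambda>x::binseq. of_bool (x i) :: real)" for i
    by (rule continuous_on_compose2[OF _ continuous_on_product_coordinates, of UNIV])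
      (auto intro: continuous_on_discrete)
  then show "\<forall>\<^sub>F n in sequentially.
      continuous_on UNIV (\<lambda>x::binseq. \<Sum>i<n. (1/2::real) ^ Suc i * of_bool (x i))"
    by (intro always_eventually allI continuous_intros)
qed simp

lemma floor_double: "\<lfloor>2 * r\<rfloor> = 2 * \<lfloor>r\<rfloor> + of_bool (odd \<lfloor>2 * r\<rfloor>)" for r :: real
proof -
  have "\<lfloor>2 * r\<rfloor> = 2 * \<lfloor>r\<rfloor> \<or> \<lfloor>2 * r\<rfloor> = 2 * \<lfloor>r\<rfloor> + 1" by linarith
  then show ?thesis by auto
qed

text \<open>For s < 1, the first n greedy digits sum to s rounded down to a multiple of (1/2)^n. The
  induction starts from floor s = 0, which fails at s = 1; there the constant sequence of ones
  serves.\<close>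

lemma bin_val_surj:
  assumes "s \<in> {0..1}"
  obtains x where "bin_val x = s"
proof (cases "s = 1")
  case True
  have "bin_val (\<lambda>_. True) = 1"
    unfolding bin_val_def using power_half_series by (simp add: sums_iff)
  then show ?thesis using that True by blast
next
  case False
  \<comment> \<open>Coordinate n has weight (1/2)^(n+1), so its digit is the last binary digit of
    the integer part of 2^(n+1) s.\<close>
  define x where "x n \<longleftrightarrow> odd \<lfloor>2 ^ Suc n * s\<rfloor>" for n
  have partial: "(\<Sum>i<n. (1/2) ^ Suc i * of_bool (x i)) = \<lfloor>2 ^ n * s\<rfloor> / 2 ^ n" for n
  proof (induction n)
    case 0
    have "\<lfloor>s\<rfloor> = 0" using assms False by (auto simp: floor_eq_iff)
    then show ?case by simp
  next
    case (Suc n)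
    have "real_of_int \<lfloor>2 ^ Suc n * s\<rfloor> = 2 * \<lfloor>2 ^ n * s\<rfloor> + of_bool (x n)"
      using arg_cong[OF floor_double[of "2 ^ n * s"], of real_of_int]
      by (simp add: x_def mult.assoc)
    then show ?case using Suc by (simp add: field_simps)
  qed
  have "(\<lambda>n. \<lfloor>2 ^ n * s\<rfloor> / 2 ^ n) \<longlonglongrightarrow> s"
  proof (rule real_tendsto_sandwich)
    show "\<forall>\<^sub>F n in sequentially. s - (1/2) ^ n \<le> \<lfloor>2 ^ n * s\<rfloor> / 2 ^ n"
    proof (intro always_eventually allI)
      fix n
      have "2 ^ n * s - 1 \<le> \<lfloor>2 ^ n * s\<rfloor>" by linarith
      then have "(2 ^ n * s - 1) / 2 ^ n \<le> \<lfloor>2 ^ n * s\<rfloor> / 2 ^ n"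
        by (rule divide_right_mono) simp
      then show "s - (1/2) ^ n \<le> \<lfloor>2 ^ n * s\<rfloor> / 2 ^ n"
        by (simp add: diff_divide_distrib power_one_over)
    qed
    show "\<forall>\<^sub>F n in sequentially. \<lfloor>2 ^ n * s\<rfloor> / 2 ^ n \<le> s"
    proof (intro always_eventually allI)
      fix n
      have "\<lfloor>2 ^ n * s\<rfloor> \<le> 2 ^ n * s" by linarith
      then show "\<lfloor>2 ^ n * s\<rfloor> / 2 ^ n \<le> s"
        by (simp add: field_simps)
    qed
    show "(\<lambda>n. s - (1/2) ^ n) \<longlonglongrightarrow> s"
      by (rule tendsto_eq_intros LIMSEQ_realpow_zero | simp)+
  qed simp
  then have "(\<lambda>n. (1/2) ^ Suc n * of_bool (x n)) sums s"
    unfolding sums_def partial .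
  then have "bin_val x = s" unfolding bin_val_def by (simp add: sums_iff)
  then show ?thesis by (rule that)
qed

text \<open>\<open>Bcontfun\<close> is inverted only on bounded continuous functions; continuity of
  the path and compactness of the sequence space put the composite there.\<close>

lemma apply_brownian_potential:
  assumes "continuous_on {0..1} (\<lambda>s. B s \<omega>)"
  shows "apply_bcontfun (brownian_potential B \<omega>) x = B (bin_val x) \<omega>"
proof -
  have "continuous_on UNIV (\<lambda>x. B (bin_val x) \<omega>)"
    by (rule continuous_on_compose2[OF assms continuous_on_bin_val])
      (use bin_val_in_unit_interval in blast)
  then have "(\<lambda>x. B (bin_val x) \<omega>) \<in> bcontfun"
    using compact_continuous_image[OF _ compact_UNIV_binseq] compact_imp_bounded
    by (auto simp: bcontfun_def)
  then show ?thesis by (simp add: brownian_potential_def Bcontfun_inverse)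
qed

section \<open>Cylinders and compactness\<close>

lemma open_cylinder: "open {y::binseq. \<forall>i<n. y i = x i}"
  unfolding open_iff_seq_dist
proof (intro ballI exI conjI allI impI)
  fix y z assume "y \<in> {y. \<forall>i<n. y i = x i}" "seq_dist y z < (1/2) ^ n"
  then show "z \<in> {y. \<forall>i<n. y i = x i}" by (auto simp: seq_dist_less_iff)
qed simp

lemma open_contains_cylinder:
  fixes U :: "binseq set"
  assumes "open U" "x \<in> U"
  obtains n where "{y. \<forall>i<n. y i = x i} \<subseteq> U"
proof -
  obtain e where e: "e > 0" "\<And>y. seq_dist x y < e \<Longrightarrow> y \<in> U"
    using assms unfolding open_iff_seq_dist by blast
  obtain n where n: "(1/2) ^ n < e"
    using real_arch_pow_inv[OF e(1), of "1/2"] by auto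
  have "y \<in> U" if "\<forall>i<n. y i = x i" for y
    using seq_dist_less_iff[of x y n] that n e(2)[of y] by auto
  then show ?thesis using that by blast
qed

text \<open>Around each x, some cylinder keeps h within a factor d of h x in both directions.
  Finitely many of these cover the space, and n bounds their lengths. Comparing u and v through a
  common centre x costs d twice.\<close>

lemma uniform_ratio_on_cylinders:
  fixes h :: "binseq \<Rightarrow> real"
  assumes h: "continuous_on UNIV h" "\<And>x. 0 < h x" and d: "1 < d"
  obtains n where "\<And>u v. (\<forall>i<n. u i = v i) \<Longrightarrow> h u \<le> d * d * h v"
proof -
  have "\<exists>n. {y. \<forall>i<n. y i = x i} \<subseteq> {y. h y < d * h x \<and> h x < d * h y}" for x
  proof -
    have "open {y. h y < d * h x \<and> h x < d * h y}"
      by (intro open_Collect_conj open_Collect_less continuous_intros h)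
    moreover have "x \<in> {y. h y < d * h x \<and> h x < d * h y}" using h(2) d by simp
    ultimately obtain n where "{y. \<forall>i<n. y i = x i} \<subseteq> {y. h y < d * h x \<and> h x < d * h y}"
      by (rule open_contains_cylinder)
    then show ?thesis by blast
  qed
  then have "\<forall>x. \<exists>n. \<forall>y. (\<forall>i<n. y i = x i) \<longrightarrow> h y < d * h x \<and> h x < d * h y"
    by (simp add: subset_eq)
  from choice[OF this]
  obtain N where N: "\<And>x y. \<forall>i<N x. y i = x i \<Longrightarrow> h y < d * h x \<and> h x < d * h y"
    by blast
  obtain F where F: "finite F" "UNIV \<subseteq> (\<Union>x\<in>F. {y. \<forall>i<N x. y i = x i})"
    by (rule compactE_image[OF compact_UNIV_binseq, of UNIV "\<lambda>x. {y. \<forall>i<N x. y i = x i}"])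
      (use open_cylinder in auto)
  obtain n where n: "\<And>x. x \<in> F \<Longrightarrow> N x \<le> n"
    using finite_nat_set_iff_bounded_le[of "N ` F"] F(1) by auto
  show ?thesis
  proof
    fix u v :: binseq assume uv: "\<forall>i<n. u i = v i"
    obtain x where x: "x \<in> F" "\<forall>i<N x. v i = x i" using F(2) by blast
    have "\<forall>i<N x. u i = x i" using x uv n[OF x(1)] by auto
    then have "h u \<le> d * h x" using N[of x u] by auto
    also have "\<dots> \<le> d * (d * h v)" using N[OF x(2)] d by (intro mult_left_mono) auto
    finally show "h u \<le> d * d * h v" by simp
  qed
qed

section \<open>Eigenfunctions on fibres of the binary value\<close>

lemma ruelle_apply:
  "apply_bcontfun (ruelle f h) x =
     exp (apply_bcontfun f (prepend False x)) * apply_bcontfun h (prepend False x) +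
     exp (apply_bcontfun f (prepend True x)) * apply_bcontfun h (prepend True x)"
  by (simp add: ruelle.rep_eq UNIV_bool)

lemma positive_eigenfunction_constant_on_fibres:
  assumes pos: "\<And>x. 0 < apply_bcontfun h x"
    and eig: "ruelle f h = l *\<^sub>R h"
    and f: "\<And>x y. bin_val x = bin_val y \<Longrightarrow> apply_bcontfun f x = apply_bcontfun f y"
    and xy: "bin_val x = bin_val y"
  shows "apply_bcontfun h x = apply_bcontfun h y"
proof -
  have eig': "l * h x = exp (f (prepend False x)) * h (prepend False x)
      + exp (f (prepend True x)) * h (prepend True x)" for x
    using arg_cong[OF eig, of "\<lambda>g. apply_bcontfun g x"] by (simp add: ruelle_apply)
  \<comment> \<open>The Ruelle operator maps the positive h to a positive function, which forces l >
    0; the descent cancels l.\<close>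
  have "0 < l * h x" unfolding eig' using pos by (intro add_pos_pos mult_pos_pos) auto
  then have l: "0 < l" using pos[of x] by (simp add: zero_less_mult_iff)
  have descent: "h u \<le> c * h v"
    if "\<And>u v. bin_val u = bin_val v \<Longrightarrow> \<forall>i<n. u i = v i \<Longrightarrow> h u \<le> c * h v"
      and "bin_val u = bin_val v" for n c u v
    \<comment> \<open>The comparison hypothesis depends on n, so it has to enter the induction along
      with the fibre condition.\<close>
    using that(1) that(2)
  proof (induction n arbitrary: u v)
    case 0
    then show ?case by simp
  next
    case (Suc n)
    \<comment> \<open>Prepending the same symbol to u and v keeps them in one fibre and lengthens
      their agreement by one. The weights exp(f) then coincide, and summing over both symbols gives
      the bound for u and v themselves.\<close>
    have "h u \<le> c * h v" if uv: "bin_val u = bin_val v" "\<forall>i<n. u i = v i" for u v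
    proof -
      have step: "exp (f (prepend a u)) * h (prepend a u)
          \<le> c * (exp (f (prepend a v)) * h (prepend a v))" for a
      proof -
        have val: "bin_val (prepend a u) = bin_val (prepend a v)"
          using uv(1) by (simp add: bin_val_prepend)
        have "\<forall>i<Suc n. prepend a u i = prepend a v i"
          using uv(2) by (auto simp: prepend_def split: nat.splits)
        from Suc.prems(1)[OF val this] show ?thesis
          using f[OF val] by (simp add: mult.left_commute)
      qed
      have "l * h u \<le> c * (l * h v)"
        unfolding eig' distrib_left by (intro add_mono step)
      then have "l * h u \<le> l * (c * h v)" by (simp add: mult.left_commute)
      then show ?thesis using l by simp
    qed
    then show ?case using Suc.IH Suc.prems(2) by blast
  qed
  have le: "h x \<le> h y" if xy: "bin_val x = bin_val y" for x y
  proof -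
    have bound: "h x \<le> d * d * h y" if "1 < d" for d
    proof -
      obtain n where n: "\<And>u v. (\<forall>i<n. u i = v i) \<Longrightarrow> h u \<le> d * d * h v"
        by (rule uniform_ratio_on_cylinders[of "apply_bcontfun h", OF _ pos \<open>1 < d\<close>])
          (auto intro: continuous_on_apply_bcontfun)
      show ?thesis using descent[of n "d * d" x y] n xy by blast
    qed
    \<comment> \<open>The length n depends on d, but the resulting bound on h x does not mention n,
      so d may tend to 1 from above.\<close>
    have "((\<lambda>d. d * d * h y) \<longlongrightarrow> 1 * 1 * h y) (at_right 1)"
      by (intro tendsto_intros)
    then have "h x \<le> 1 * 1 * h y"
      by (rule tendsto_lowerbound) (auto simp: eventually_at_filter bound)
    then show ?thesis by simp
  qed
  from le[OF xy] le[OF xy[symmetric]] show ?thesis by simp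
qed

section \<open>Inverting Theta on fibre-constant functions\<close>

lemma lex_less_asym: "lex_less x y \<Longrightarrow> \<not> lex_less y x"
  unfolding lex_less_def by (metis linorder_neqE_nat)

text \<open>Only the smaller point of a two-point fibre receives a left limit. The larger one
  receives the value of F itself, and constancy carries it over.\<close>

lemma Theta_constant_on_fibres:
  assumes const: "\<And>x y. bin_val x = bin_val y \<Longrightarrow> Theta F x = Theta F y"
  shows "Theta F x = F (bin_val x)"
proof (cases "bin_val x \<in> double_points \<and> (\<exists>y. bin_val y = bin_val x \<and> lex_less x y)")
  case True
  then obtain y where y: "bin_val y = bin_val x" "lex_less x y" by blast
  have "card {z. bin_val z = bin_val x} = 2" using True by (simp add: double_points_def)
  moreover have "x \<noteq> y" using y lex_less_asym by blast
  ultimately have fibre: "{z. bin_val z = bin_val x} = {x, y}"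
    using y(1) by (intro card_subset_eq[symmetric] card_ge_0_finite) auto
  \<comment> \<open>The fibre is exactly {x, y}, so asymmetry of the order excludes both candidates
    for a point above y.\<close>
  have "\<not> (\<exists>z. bin_val z = bin_val y \<and> lex_less y z)"
  proof
    assume "\<exists>z. bin_val z = bin_val y \<and> lex_less y z"
    then obtain z where z: "lex_less y z" "z = x \<or> z = y" using fibre y(1) by auto
    then show False using lex_less_asym y(2) by blast
  qed
  then have "Theta F y = F (bin_val y)" by (auto simp: Theta_def)
  then show ?thesis using const[OF y(1)] y(1) by simp
next
  case False
  then show ?thesis unfolding Theta_def by (rule if_not_P)
qed

theorem mainTheorem4:
  fixes M :: "'w measure"
    and B :: "real \<Rightarrow> 'w \<Rightarrow> real"
    and lamB :: "'w \<Rightarrow> real"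
    and hB :: "'w \<Rightarrow> (binseq \<Rightarrow>\<^sub>C real)"
    and X :: "real \<Rightarrow> 'w \<Rightarrow> real"
  assumes "prob_space M" and "complete_measure M"
    and "std_brownian_motion M B"
    and "\<And>\<omega>. lamB \<omega> = main_eigenvalue (brownian_potential B \<omega>)"
    and "AE \<omega> in M. is_positive_main_eigenfunction (brownian_potential B \<omega>) (hB \<omega>)"
    and "AE \<omega> in M. (\<lambda>s. X s \<omega>) \<in> D_paths \<and> Theta (\<lambda>s. X s \<omega>) = apply_bcontfun (hB \<omega>)"
  shows "AE \<omega> in M. \<forall>t\<in>{0..1}.
           exp (B (t/2) \<omega>) * X (t/2) \<omega> + exp (B (1/2 + t/2) \<omega>) * X (1/2 + t/2) \<omega>
             = lamB \<omega> * X t \<omega>"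
proof -
  have "AE \<omega> in M. continuous_on {0..1} (\<lambda>s. B s \<omega>)"
    using assms(3) by (simp add: std_brownian_motion_def)
  then show ?thesis
    using assms(5,6)
  proof eventually_elim
    case (elim \<omega>)
    note pot = apply_brownian_potential[where B = B and \<omega> = \<omega>, OF elim(1)]
    have pos: "\<And>x. 0 < apply_bcontfun (hB \<omega>) x"
      and eig: "ruelle (brownian_potential B \<omega>) (hB \<omega>) = lamB \<omega> *\<^sub>R hB \<omega>"
      using elim(2) by (auto simp: is_positive_main_eigenfunction_def assms(4))
    have Theta: "Theta (\<lambda>s. X s \<omega>) = apply_bcontfun (hB \<omega>)" using elim(3) by simp
    \<comment> \<open>The remaining premise says that the potential is constant on fibres: by
      \<open>pot\<close> it depends on its argument only through \<open>bin_val\<close>.\<close>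
    have "Theta (\<lambda>s. X s \<omega>) x = Theta (\<lambda>s. X s \<omega>) y" if "bin_val x = bin_val y" for x y
      unfolding Theta
      by (rule positive_eigenfunction_constant_on_fibres[OF pos eig _ that]) (simp add: pot)
    then have h: "apply_bcontfun (hB \<omega>) x = X (bin_val x) \<omega>" for x
      unfolding Theta[symmetric] by (rule Theta_constant_on_fibres)
    show ?case
    proof
      fix t :: real assume "t \<in> {0..1}"
      then obtain x where x: "bin_val x = t" by (rule bin_val_surj)
      show "exp (B (t/2) \<omega>) * X (t/2) \<omega> + exp (B (1/2 + t/2) \<omega>) * X (1/2 + t/2) \<omega>
          = lamB \<omega> * X t \<omega>"
        using arg_cong[OF eig, of "\<lambda>g. apply_bcontfun g x"] x
        by (simp add: ruelle_apply pot h bin_val_prepend)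
    qed
  qed
qed

end
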